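(* Let $f$ be a smooth convex scalar function of a real variable with a unique extreme point (minimizer) $t^*$, and let $p>0$. Suppose $f$ is $p$-order strong convex: there is $\lambda>0$ with $|f^{(1)}(x)-f^{(1)}(y)|\ge\lambda|x-y|^p$ for all $x,y$ in the domain of $f$. Let $0<\alpha<2$ and $\rho>0$, and consider the fractional order gradient method $$t_{k+2}=t_{k+1}-\rho f^{(1)}(t_{k+1})\,|t_{k+1}-t_k|^{1-\alpha},\qquad k\ge1.$$ Then a necessary condition for the asymptotical convergence of the method is $\alpha\le p$; that is, if the iterates $t_k$ generated by the method converge to $t^*$ as $k\to\infty$, then $\alpha\le p$.
   Context: $f^{(1)}$ denotes the first derivative of $f$. The method is started from two real initial points $t_1,t_2$ and produces the iterates $t_3,t_4,\dots$ by the recursion. Asymptotical convergence means $\lim_{k\to\infty}t_k=t^*$. *)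

theory Defs
  imports "HOL-Analysis.Analysis"
begin

definition smooth_fun_on :: "real set \<Rightarrow> (real \<Rightarrow> real) \<Rightarrow> bool" where
  "smooth_fun_on D f \<longleftrightarrow> (\<forall>n. \<forall>x\<in>D. (deriv ^^ n) f differentiable (at x))"

definition order_strong_convex_on :: "real \<Rightarrow> real set \<Rightarrow> (real \<Rightarrow> real) \<Rightarrow> bool" where
  "order_strong_convex_on p D f \<longleftrightarrow>
     (\<exists>l>0. \<forall>x\<in>D. \<forall>y\<in>D. \<bar>deriv f x - deriv f y\<bar> \<ge> l * \<bar>x - y\<bar> powr p)"

definition unique_minimizer_on :: "real set \<Rightarrow> (real \<Rightarrow> real) \<Rightarrow> real \<Rightarrow> bool" where
  "unique_minimizer_on D f m \<longleftrightarrow> (\<forall>x. is_arg_min f (\<lambda>x. x \<in> D) x \<longleftrightarrow> x = m)"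

text \<open>
  Real power of a nonnegative base with the usual convention that the zeroth power is 1
  (whereas \<open>0 powr 0 = 0\<close>).
\<close>

definition rpow :: "real \<Rightarrow> real \<Rightarrow> real" where
  "rpow x a = (if a = 0 then 1 else x powr a)"

text \<open>
  \<open>t\<close> is an infinite run of the method with initial points \<open>t 1\<close>, \<open>t 2\<close>; the value \<open>t 0\<close> is
  irrelevant.  For \<open>\<alpha> > 1\<close> the factor \<open>\<bar>t (k+1) - t k\<bar>\<close> carries a negative exponent, so the
  recursion only makes sense if consecutive iterates differ.  This has to be said explicitly,
  since \<open>powr\<close> is total with \<open>0 powr a = 0\<close>.
\<close>

definition fractional_gradient_iterates ::
    "real \<Rightarrow> real \<Rightarrow> real set \<Rightarrow> (real \<Rightarrow> real) \<Rightarrow> (nat \<Rightarrow> real) \<Rightarrow> bool" where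
  "fractional_gradient_iterates \<alpha> \<rho> D f t \<longleftrightarrow>
     (\<forall>k\<ge>1. t k \<in> D \<and>
        (1 - \<alpha> < 0 \<longrightarrow> t (k + 1) \<noteq> t k) \<and>
        t (k + 2) = t (k + 1) - \<rho> * deriv f (t (k + 1)) * rpow \<bar>t (k + 1) - t k\<bar> (1 - \<alpha>))"

end

theory Submission
  imports Defs
begin

text \<open>
  Suppose \<open>p < \<alpha>\<close>, so \<open>p < 2\<close>.  Comparing \<open>\<lambda> \<bar>x - t\<^sup>*\<bar>\<^sup>p \<le> \<bar>f' x\<bar>\<close> with the Taylor expansion of \<open>f'\<close>
  at \<open>t\<^sup>*\<close> forces \<open>p \<ge> 1\<close> (as \<open>f'\<close> is \<open>O(\<bar>x - t\<^sup>*\<bar>)\<close>) and \<open>f'' t\<^sup>* \<noteq> 0\<close> (otherwise \<open>f'\<close> would be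
  \<open>O(\<bar>x - t\<^sup>*\<bar>\<^sup>2)\<close>).  Hence \<open>\<alpha> > 1\<close> and \<open>\<bar>f' x\<bar> \<ge> c \<bar>x - t\<^sup>*\<bar>\<close> near \<open>t\<^sup>*\<close>.  If the iterates converged,
  the factor \<open>\<bar>t\<^sub>k\<^sub>+\<^sub>1 - t\<^sub>k\<bar>\<^bsup>1-\<alpha>\<^esup>\<close> would tend to infinity, so a step would eventually be at least twice
  the current error, and the errors could no longer decrease to \<open>0\<close>.
\<close>

lemma deriv_imp_local_Lipschitz_at:
  fixes g :: "real \<Rightarrow> real"
  assumes "(g has_real_derivative a) (at s)"
  obtains C where "C > 0" "\<forall>\<^sub>F x in nhds s. \<bar>g x - g s\<bar> \<le> C * \<bar>x - s\<bar>"
proof -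
  have "((\<lambda>x. \<bar>(g x - g s) / (x - s)\<bar>) \<longlongrightarrow> \<bar>a\<bar>) (at s)"
    using assms by (intro tendsto_rabs) (simp add: has_field_derivative_iff)
  then have "\<forall>\<^sub>F x in at s. \<bar>(g x - g s) / (x - s)\<bar> < \<bar>a\<bar> + 1"
    by (rule order_tendstoD) simp
  then have "\<forall>\<^sub>F x in at s. \<bar>g x - g s\<bar> \<le> (\<bar>a\<bar> + 1) * \<bar>x - s\<bar>"
    using eventually_neq_at_within[of s s UNIV]
    by eventually_elim (simp add: abs_divide field_simps)
  \<comment> \<open>Passing from the punctured to the full neighbourhood costs nothing, since both
    sides vanish at \<open>s\<close>.\<close>
  then have "\<forall>\<^sub>F x in nhds s. \<bar>g x - g s\<bar> \<le> (\<bar>a\<bar> + 1) * \<bar>x - s\<bar>"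
    unfolding eventually_at_filter by (rule eventually_mono) auto
  then show thesis
    by (intro that[of "\<bar>a\<bar> + 1"]) auto
qed

lemma deriv_nonzero_imp_linear_growth_at:
  fixes g :: "real \<Rightarrow> real"
  assumes "(g has_real_derivative a) (at s)" and "a \<noteq> 0"
  obtains c where "c > 0" "\<forall>\<^sub>F x in nhds s. c * \<bar>x - s\<bar> \<le> \<bar>g x - g s\<bar>"
proof -
  have "((\<lambda>x. \<bar>(g x - g s) / (x - s)\<bar>) \<longlongrightarrow> \<bar>a\<bar>) (at s)"
    using assms by (intro tendsto_rabs) (simp add: has_field_derivative_iff)
  \<comment> \<open>Half of the limit \<open>\<bar>a\<bar>\<close> is strictly below it exactly
    because \<open>a\<close> is nonzero.\<close>
  then have "\<forall>\<^sub>F x in at s. \<bar>a\<bar> / 2 < \<bar>(g x - g s) / (x - s)\<bar>"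
    by (rule order_tendstoD) (use assms in simp)
  then have "\<forall>\<^sub>F x in at s. \<bar>a\<bar> / 2 * \<bar>x - s\<bar> \<le> \<bar>g x - g s\<bar>"
    using eventually_neq_at_within[of s s UNIV]
    by eventually_elim (simp add: abs_divide field_simps)
  then have "\<forall>\<^sub>F x in nhds s. \<bar>a\<bar> / 2 * \<bar>x - s\<bar> \<le> \<bar>g x - g s\<bar>"
    unfolding eventually_at_filter by (rule eventually_mono) auto
  then show thesis
    using assms(2) by (intro that[of "\<bar>a\<bar> / 2"]) auto
qed

text \<open>Since \<open>h\<close> vanishes at \<open>s\<close> and is differentiable there, it is
  bounded by a multiple of \<open>\<bar>x - s\<bar>\<close>. The mean value inequality for
  \<open>g\<close> between \<open>s\<close> and \<open>x\<close> contributes a second factor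
  \<open>\<bar>x - s\<bar>\<close>.\<close>

lemma second_order_bound_at:
  fixes g h :: "real \<Rightarrow> real"
  assumes g: "\<forall>\<^sub>F x in nhds s. (g has_real_derivative h x) (at x)"
    and h: "(h has_real_derivative b) (at s)" and "h s = 0"
  obtains C where "C > 0" "\<forall>\<^sub>F x in nhds s. \<bar>g x - g s\<bar> \<le> C * \<bar>x - s\<bar>\<^sup>2"
proof -
  obtain C where C: "C > 0" "\<forall>\<^sub>F x in nhds s. \<bar>h x\<bar> \<le> C * \<bar>x - s\<bar>"
    using deriv_imp_local_Lipschitz_at[OF h] \<open>h s = 0\<close> by auto
  obtain e where e: "e > 0"
    "\<And>x. dist x s < e \<Longrightarrow> (g has_real_derivative h x) (at x) \<and> \<bar>h x\<bar> \<le> C * \<bar>x - s\<bar>"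
    using eventually_conj[OF g C(2)] unfolding eventually_nhds_metric by blast
  have "\<bar>g x - g s\<bar> \<le> C * \<bar>x - s\<bar>\<^sup>2" if x: "dist x s < e" for x
  proof -
    have "norm (g x - g s) \<le> (C * \<bar>x - s\<bar>) * norm (x - s)"
    proof (rule field_differentiable_bound[where S = "closed_segment s x" and f' = h])
      fix z assume "z \<in> closed_segment s x"
      then have z: "\<bar>z - s\<bar> \<le> \<bar>x - s\<bar>"
        using dist_in_closed_segment[of z s x] by (simp add: dist_real_def abs_minus_commute)
      then have "dist z s < e"
        using x by (simp add: dist_real_def)
      note ez = e(2)[OF this]
      show "(g has_field_derivative h z) (at z within closed_segment s x)"
        using ez has_field_derivative_at_within by blast
      show "norm (h z) \<le> C * \<bar>x - s\<bar>"
        using ez mult_left_mono[OF z, of C] C(1) by (auto intro: order_trans)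
    qed auto
    then show ?thesis
      by (simp add: power2_eq_square)
  qed
  then show thesis
    using that C(1) e(1) unfolding eventually_nhds_metric by blast
qed

text \<open>Dividing by \<open>\<bar>x - s\<bar> powr p\<close> leaves the positive constant
  \<open>l\<close> below \<open>C * \<bar>x - s\<bar> powr (q - p)\<close>, which would tend to 0 if
  \<open>q\<close> exceeded \<open>p\<close>. The sign of \<open>C\<close> does not matter.\<close>

lemma powr_local_comparison:
  fixes s l C p q :: real
  assumes "l > 0"
    and le: "\<forall>\<^sub>F x in at s. l * \<bar>x - s\<bar> powr p \<le> C * \<bar>x - s\<bar> powr q"
  shows "q \<le> p"
proof (rule ccontr)
  assume "\<not> q \<le> p"
  then have "((\<lambda>x. \<bar>x - s\<bar> powr (q - p)) \<longlongrightarrow> 0) (at s)"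
    by (intro tendsto_zero_powrI[where b = "q - p"]) (auto intro!: tendsto_eq_intros)
  then have "((\<lambda>x. C * \<bar>x - s\<bar> powr (q - p)) \<longlongrightarrow> 0) (at s)"
    using tendsto_mult_right_zero by blast
  moreover have "\<forall>\<^sub>F x in at s. l \<le> C * \<bar>x - s\<bar> powr (q - p)"
    using le eventually_neq_at_within[of s s UNIV]
    by eventually_elim (simp add: powr_diff field_simps)
  ultimately have "l \<le> 0"
    by (intro tendsto_lowerbound) auto
  with \<open>l > 0\<close> show False by simp
qed

text \<open>Overshooting makes the errors eventually nondecreasing, so they can tend to 0 only if
  some iterate hits \<open>s\<close> exactly. That case is excluded because consecutive iterates
  differ.\<close>

lemma fractional_gradient_not_convergent:
  fixes g :: "real \<Rightarrow> real" and t :: "nat \<Rightarrow> real"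
  assumes "\<alpha> > 1" "\<rho> > 0" "c > 0" "g s = 0"
    and growth: "\<forall>\<^sub>F x in nhds s. c * \<bar>x - s\<bar> \<le> \<bar>g x\<bar>"
    and neq: "\<And>k. k \<ge> 1 \<Longrightarrow> t (k + 1) \<noteq> t k"
    and step: "\<And>k. k \<ge> 1 \<Longrightarrow>
      t (k + 2) = t (k + 1) - \<rho> * g (t (k + 1)) * \<bar>t (k + 1) - t k\<bar> powr (1 - \<alpha>)"
  shows "\<not> t \<longlonglongrightarrow> s"
proof
  assume t: "t \<longlonglongrightarrow> s"
  then have t1: "(\<lambda>k. t (k + 1)) \<longlonglongrightarrow> s"
    by (rule LIMSEQ_ignore_initial_segment)
  have "(\<lambda>k. \<bar>t (k + 1) - t k\<bar> powr (\<alpha> - 1)) \<longlonglongrightarrow> 0"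
    by (intro tendsto_zero_powrI[where b = "\<alpha> - 1"])
      (use t t1 \<open>\<alpha> > 1\<close> in \<open>auto intro!: tendsto_eq_intros\<close>)
  \<comment> \<open>The threshold \<open>\<rho> * c / 2\<close> is chosen so that inverting the
    power gives \<open>2 \<le> \<rho> * c * \<bar>t (k + 1) - t k\<bar> powr (1 -
    \<alpha>)\<close>.\<close>
  then have small: "\<forall>\<^sub>F k in sequentially. \<bar>t (k + 1) - t k\<bar> powr (\<alpha> - 1) < \<rho> * c / 2"
    by (rule order_tendstoD) (use assms in simp)
  have "\<forall>\<^sub>F k in sequentially. \<bar>t (k + 1) - s\<bar> \<le> \<bar>t (k + 2) - s\<bar>"
    using small eventually_compose_filterlim[OF growth t1] eventually_ge_at_top[of 1]
  proof eventually_elim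
    case (elim k)
    let ?d = "\<bar>t (k + 1) - t k\<bar>"
    have d: "?d > 0"
      using neq[OF elim(3)] by simp
    have "2 \<le> \<rho> * c * ?d powr (1 - \<alpha>)"
    proof -
      have "2 = 2 * ?d powr (\<alpha> - 1) * ?d powr (1 - \<alpha>)"
        using d by (simp add: mult.assoc flip: powr_add)
      also have "\<dots> \<le> \<rho> * c * ?d powr (1 - \<alpha>)"
        using elim(1) by (intro mult_right_mono) auto
      finally show ?thesis .
    qed
    then have "2 * \<bar>t (k + 1) - s\<bar> \<le> \<rho> * c * ?d powr (1 - \<alpha>) * \<bar>t (k + 1) - s\<bar>"
      by (rule mult_right_mono) simp
    also have "\<dots> = \<rho> * ?d powr (1 - \<alpha>) * (c * \<bar>t (k + 1) - s\<bar>)"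
      by simp
    also have "\<dots> \<le> \<rho> * ?d powr (1 - \<alpha>) * \<bar>g (t (k + 1))\<bar>"
      using elim(2) \<open>\<rho> > 0\<close> by (intro mult_left_mono) auto
    also have "\<dots> = \<bar>t (k + 2) - t (k + 1)\<bar>"
      using \<open>\<rho> > 0\<close> by (simp add: step[OF elim(3)] abs_mult del: One_nat_def add_2_eq_Suc')
    \<comment> \<open>A step is at most the sum of the errors before and after it. As it is at least
      twice the former, the latter cannot be smaller.\<close>
    finally show ?case
      using abs_triangle_ineq4[of "t (k + 2) - s" "t (k + 1) - s"] by simp
  qed
  then obtain N where N: "\<And>k. k \<ge> N \<Longrightarrow> \<bar>t (k + 1) - s\<bar> \<le> \<bar>t (k + 2) - s\<bar>"
    unfolding eventually_sequentially by blast
  \<comment> \<open>The recursion is available only from index 1 on.\<close>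
  define M where "M = max N 1"
  have "\<bar>t (M + 1) - s\<bar> \<le> \<bar>t (k + 1) - s\<bar>" if "k \<ge> M" for k
    using that
  proof (induction k rule: dec_induct)
    case (step n)
    then show ?case using N[of n] by (simp add: M_def)
  qed simp
  then have "\<forall>\<^sub>F k in sequentially. \<bar>t (M + 1) - s\<bar> \<le> \<bar>t (k + 1) - s\<bar>"
    unfolding eventually_sequentially by blast
  moreover have "(\<lambda>k. \<bar>t (k + 1) - s\<bar>) \<longlonglongrightarrow> 0"
    using t1 LIM_zero tendsto_rabs_zero by blast
  \<comment> \<open>So \<open>t (M + 1)\<close> equals \<open>s\<close>. The gradient vanishes
    there, and the next iterate would coincide with it.\<close>
  ultimately have "\<bar>t (M + 1) - s\<bar> \<le> 0"
    by (intro tendsto_lowerbound) auto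
  then have "t (M + 2) = t (M + 1)"
    using step[of M] \<open>g s = 0\<close> by (simp add: M_def)
  moreover have "t (M + 1 + 1) \<noteq> t (M + 1)"
    by (rule neq) simp
  ultimately show False by simp
qed

theorem theorem7:
  fixes D :: "real set" and f :: "real \<Rightarrow> real" and t :: "nat \<Rightarrow> real"
    and tstar p \<alpha> \<rho> :: real
  assumes "open D"
    and "smooth_fun_on D f"
    and "convex_on D f"
    and "unique_minimizer_on D f tstar"
    and "p > 0"
    and "order_strong_convex_on p D f"
    and "0 < \<alpha>" and "\<alpha> < 2"
    and "\<rho> > 0"
    and "fractional_gradient_iterates \<alpha> \<rho> D f t"
    and "t \<longlonglongrightarrow> tstar"
  shows "\<alpha> \<le> p"
proof (rule ccontr)
  assume "\<not> \<alpha> \<le> p"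
  let ?g = "deriv f" and ?h = "deriv (deriv f)"
  have smooth: "(deriv ^^ n) f differentiable (at x)" if "x \<in> D" for n x
    using assms(2) that unfolding smooth_fun_on_def by blast
  have df: "(f has_real_derivative ?g x) (at x)"
    and dg: "(?g has_real_derivative ?h x) (at x)"
    and dh: "(?h has_real_derivative deriv ?h x) (at x)" if "x \<in> D" for x
    using smooth[OF that, of 0] smooth[OF that, of 1] smooth[OF that, of 2]
    by (simp_all add: DERIV_deriv_iff_real_differentiable numeral_2_eq_2)
  have "is_arg_min f (\<lambda>x. x \<in> D) tstar"
    using assms(4) unfolding unique_minimizer_on_def by blast
  then have sD: "tstar \<in> D" and min: "\<And>y. y \<in> D \<Longrightarrow> f tstar \<le> f y"
    by (auto simp: is_arg_min_def not_less)
  obtain e where e: "e > 0" "\<And>y. dist y tstar < e \<Longrightarrow> y \<in> D"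
    using \<open>open D\<close> sD unfolding open_dist by blast
  have g0: "?g tstar = 0"
    by (rule DERIV_local_min[OF df[OF sD] e(1)])
      (use e min in \<open>auto simp: dist_real_def abs_minus_commute\<close>)
  have inD: "\<forall>\<^sub>F x in nhds tstar. x \<in> D"
    using \<open>open D\<close> sD by (rule eventually_nhds_in_open)
  obtain l where l: "l > 0" "\<And>x. x \<in> D \<Longrightarrow> l * \<bar>x - tstar\<bar> powr p \<le> \<bar>?g x\<bar>"
    using assms(6) sD g0 unfolding order_strong_convex_on_def by fastforce
  \<comment> \<open>Any local power bound on the gradient at \<open>tstar\<close> competes with the
    lower bound of order \<open>p\<close>. It is used below with exponents 1 and 2.\<close>
  have upper: "q \<le> p" if "\<forall>\<^sub>F x in nhds tstar. \<bar>?g x\<bar> \<le> C * \<bar>x - tstar\<bar> powr q" for C q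
  proof (rule powr_local_comparison[OF l(1)])
    have "\<forall>\<^sub>F x in nhds tstar. l * \<bar>x - tstar\<bar> powr p \<le> C * \<bar>x - tstar\<bar> powr q"
      using that inD by eventually_elim (use l(2) in force)
    then show "\<forall>\<^sub>F x in at tstar. l * \<bar>x - tstar\<bar> powr p \<le> C * \<bar>x - tstar\<bar> powr q"
      unfolding eventually_at_filter by (rule eventually_mono) auto
  qed
  obtain C1 where "\<forall>\<^sub>F x in nhds tstar. \<bar>?g x\<bar> \<le> C1 * \<bar>x - tstar\<bar>"
    using deriv_imp_local_Lipschitz_at[OF dg[OF sD]] g0 by auto
  then have "1 \<le> p"
    by (intro upper[of C1 1]) simp
  with \<open>\<not> \<alpha> \<le> p\<close> have "\<alpha> > 1" by simp
  have "?h tstar \<noteq> 0"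
  proof
    assume "?h tstar = 0"
    have "\<forall>\<^sub>F x in nhds tstar. (?g has_real_derivative ?h x) (at x)"
      using inD by eventually_elim (rule dg)
    from second_order_bound_at[OF this dh[OF sD] \<open>?h tstar = 0\<close>] obtain C2 where "\<forall>\<^sub>F x in nhds tstar. \<bar>?g x\<bar> \<le> C2 * \<bar>x - tstar\<bar>\<^sup>2"
      using g0 by auto
    then have "2 \<le> p"
      by (intro upper[of C2 2]) simp
    with \<open>\<not> \<alpha> \<le> p\<close> \<open>\<alpha> < 2\<close> show False by simp
  qed
  then obtain c where c: "c > 0" "\<forall>\<^sub>F x in nhds tstar. c * \<bar>x - tstar\<bar> \<le> \<bar>?g x\<bar>"
    using deriv_nonzero_imp_linear_growth_at[OF dg[OF sD]] g0 by auto
  \<comment> \<open>As \<open>\<alpha> > 1\<close>, the exponent \<open>1 - \<alpha>\<close> is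
    negative: \<open>rpow\<close> reduces to \<open>powr\<close>, and the definition of the method
    supplies that consecutive iterates differ.\<close>
  have "\<not> t \<longlonglongrightarrow> tstar"
    by (rule fractional_gradient_not_convergent[OF \<open>\<alpha> > 1\<close> \<open>\<rho> > 0\<close> c(1) g0 c(2)])
      (use assms(10) \<open>\<alpha> > 1\<close> in \<open>auto simp: fractional_gradient_iterates_def rpow_def\<close>)
  with assms(11) show False by contradiction
qed

end
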